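(* Consider $\{u_i^e\}_{i=1}^{N_x}$, a set of cell averages of a stationary solution $u^e$ of the one-dimensional hyperbolic balance law $\partial_t u+\partial_x F(u)=S(u,x)$, i.e. $\partial_x F(u^e)=S(u^e,x)$. Let $\mathcal S_1^{\mathrm{exp,FV}}$ be the first-order explicit finite volume kinetic relaxation scheme constructed in the context. Then $$\forall i\in\{1,\dots,N_x\},\qquad \mathcal S_1^{\mathrm{exp,FV}}(\Delta t)(u_i^e)=u_i^e.$$ That is, the scheme is exactly well-balanced: if $u_i^n=u_i^e$ for all $i$, then $u_i^{n+1}=u_i^e$ for all $i$.
   Context: **Balance law.** $u(x,t)$ takes values in an open convex set $\Omega\subset\mathbb R^m$. The flux $F:\Omega\to\mathbb R^m$ is sufficiently regular and such that the Jacobian $\nabla_uF(u)$ is diagonalizable with real eigenvalues for all $u\in\Omega$. The source is $S:\Omega\times\mathbb R\to\mathbb R^m$. **Kinetic equilibria.** $\lambda>0$ is the kinetic speed, at least as large as the absolute values of the eigenvalues of $\nabla_uF$ (subcharacteristic condition; in practice the largest velocity among the stationary and the transient solution is taken). The kinetic equilibrium functions are $m_\pm(u)=\frac u2\pm\frac{F(u)}{2\lambda}$, so $m_++m_-=u$ and $\lambda m_+-\lambda m_-=F(u)$. The kinetic unknowns $f_\pm$ satisfy $f_++f_-=u$ and are initialized by $f_\pm^0=m_\pm(u^0)$, where $u^0$ is the initial condition. Accordingly, the scheme applied to the data $u_i^e$ starts from $f_{\pm,i}=m_\pm(u_i^e)$. **Mesh.** $[a,b]$ is divided into $N_x$ uniform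 cells $I_i=(x_{i-1/2},x_{i+1/2})$ of length $\Delta x$ and center $x_i$. Values needed outside the domain come from ghost cells on both sides; the boundary treatment is not specified in the statement. Cell averages are computed by a quadrature formula with nodes $x_i^m\in I_i$ and weights $\omega_m$, $m=1,\dots,M$ (or exactly, if available). $u_i^n$ denotes the cell average at time $t^n$, and $\mathcal S_i$ is a stencil of cells around cell $i$. **Well-balanced reconstruction.** From the averages $\{u_j^n\}$, in each cell $i$: 1. Find a stationary solution $u_i^{e,n}$ of the balance law, defined on $\mathcal S_i$, with $\sum_m\omega_m u_i^{e,n}(x_i^m)=u_i^n$; if no such solution exists, set $u_i^{e,n}=0$. 2. Compute the fluctuations $v_j=u_j^n-\sum_m\omega_m u_i^{e,n}(x_j^m)$ for $j\in\mathcal S_i$. 3. Set $P_i^n(x)=u_i^{e,n}(x)+Q_i(x;\{v_j\}_{j\in\mathcal S_i})$, where $Q_i$ is a standard reconstruction operator that is exact for the zero function. The operator $P_i^n$ is exactly well-balanced for $u^e$: when the averages are $\{u_j^e\}$, one has $P_i^n(x)=u^e(x)$ for all $i$ and all $x\in I_i$. **The scheme.** Set $P^n_{\pm,i}(x)=m_\pm(P_i^n(x))$ and $f^{e,n}_{\pm,i}(x)=m_\pm(u_i^{e,n}(x))$. Let $f_{\pm,i}^n$ approximate the average of $f_\pm(\cdot,t^n)$ on $I_i$. Transport step: $$f_{\pm,i}^{n,*}=f_{\pm,i}^n\mp\lambda\frac{\Delta t}{\Delta x}\big(F^n_{\pm,i+1/2}-F^n_{\pm,i-1/2}\big)\pm\lambda\frac{\Delta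 t}{\Delta x}\big(f^{e,n}_{\pm,i}(x_{i+1/2})-f^{e,n}_{\pm,i}(x_{i-1/2})\big),$$ with $F^n_{-,i+1/2}=P^n_{-,i+1}(x_{i+1/2})$ and $F^n_{+,i+1/2}=P^n_{+,i}(x_{i+1/2})$; then $u_i^{n,*}=f_{-,i}^{n,*}+f_{+,i}^{n,*}$. Source step: for each $i$, solve the potentially nonlinear system $$u_i^{n+1,*}=u_i^{n,*}+\frac{\Delta t}{2}\big(S(u_i^{n,*},x_i)+S(u_i^{n+1,*},x_i)-2S(u_i^{e,n},x_i)\big),$$ where $u_i^{e,n}$ written without argument is the cell average of the local stationary solution on $I_i$. Projection step, with $\omega=2-C\Delta t$ for a constant $C$: $$f_{\pm,i}^{n+1}=(1-\omega)f_{\pm,i}^{n,*}+\omega\,\frac{m_\pm(u_i^{n,*})+m_\pm(u_i^{n+1,*})}{2},\qquad u_i^{n+1}=f_{-,i}^{n+1}+f_{+,i}^{n+1}.$$ $\mathcal S_1^{\mathrm{exp,FV}}(\Delta t)$ is the composition of the transport step followed by the source and projection steps.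
   Formalization: Assumes that the local stationary solution found in each cell is u^e itself on that cell, and that ghost cells hold averages of u^e (continuous, classical). The step always admits u^e as result; it is the only result in cells where the implicit source system has at most one solution. *)

theory Defs
  imports "HOL-Analysis.Analysis"
begin

text \<open>
  All ingredients of the scheme. Cells are indexed by integers: \<open>1..Nx\<close> are the cells of
  \<open>[a,b]\<close>, and \<open>ngh\<close> ghost cells are added on each side. The stencil of cell \<open>i\<close> is the block of
  cells \<open>i - sl i, \<dots>, i + sr i\<close>. \<open>avg j w\<close> is the average of \<open>w\<close> on cell \<open>j\<close>.
  \<open>locsol u i\<close> is the local stationary solution selected in cell \<open>i\<close> from the averages \<open>u\<close>, and
  \<open>Qop i v\<close> is the standard reconstruction in cell \<open>i\<close> of the averages \<open>v\<close>. \<open>Cproj\<close> is the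
  constant \<open>C\<close> in \<open>\<omega> = 2 - C \<Delta>t\<close>.
\<close>

record ('m::finite) kinetic_fv =
  Om :: "(real^'m) set"
  flux :: "real^'m \<Rightarrow> real^'m"
  src :: "real^'m \<Rightarrow> real \<Rightarrow> real^'m"
  kspeed :: real
  left_end :: real
  right_end :: real
  Nx :: nat
  ngh :: nat
  sl :: "int \<Rightarrow> nat"
  sr :: "int \<Rightarrow> nat"
  avg :: "int \<Rightarrow> (real \<Rightarrow> real^'m) \<Rightarrow> real^'m"
  locsol :: "(int \<Rightarrow> real^'m) \<Rightarrow> int \<Rightarrow> real \<Rightarrow> real^'m"
  Qop :: "int \<Rightarrow> (int \<Rightarrow> real^'m) \<Rightarrow> real \<Rightarrow> real^'m"
  Cproj :: real


section \<open>Balance law and kinetic equilibria\<close>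

definition diagonalizable_real :: "real^'m^'m \<Rightarrow> bool" where
  "diagonalizable_real A \<longleftrightarrow>
     (\<exists>(P::real^'m^'m) (D::real^'m^'m). invertible P \<and> (\<forall>i j. i \<noteq> j \<longrightarrow> D $ i $ j = 0) \<and> A ** P = P ** D)"

definition eigenvalue_of :: "real^'m^'m \<Rightarrow> real \<Rightarrow> bool" where
  "eigenvalue_of A c \<longleftrightarrow> (\<exists>v. v \<noteq> 0 \<and> A *v v = c *\<^sub>R v)"

definition hyperbolic_law :: "('m::finite) kinetic_fv \<Rightarrow> bool" where
  "hyperbolic_law K \<longleftrightarrow>
     open (Om K) \<and> convex (Om K) \<and>
     (\<forall>u\<in>Om K. flux K differentiable (at u)) \<and>
     continuous_on (Om K) (\<lambda>u. jacobian (flux K) (at u)) \<and>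
     (\<forall>u\<in>Om K. diagonalizable_real (jacobian (flux K) (at u)))"

text \<open>
  The bound is required on a set \<open>U\<close> of relevant states, because the eigenvalues may be unbounded
  on all of \<open>Om K\<close>.
\<close>

definition subcharacteristic :: "('m::finite) kinetic_fv \<Rightarrow> (real^'m) set \<Rightarrow> bool" where
  "subcharacteristic K U \<longleftrightarrow>
     (\<forall>u\<in>U. \<forall>c. eigenvalue_of (jacobian (flux K) (at u)) c \<longrightarrow> \<bar>c\<bar> \<le> kspeed K)"

definition mplus :: "('m::finite) kinetic_fv \<Rightarrow> real^'m \<Rightarrow> real^'m" where
  "mplus K u = (1/2) *\<^sub>R u + (1 / (2 * kspeed K)) *\<^sub>R flux K u"

definition mminus :: "('m::finite) kinetic_fv \<Rightarrow> real^'m \<Rightarrow> real^'m" where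
  "mminus K u = (1/2) *\<^sub>R u - (1 / (2 * kspeed K)) *\<^sub>R flux K u"

definition stationary_on :: "('m::finite) kinetic_fv \<Rightarrow> real set \<Rightarrow> (real \<Rightarrow> real^'m) \<Rightarrow> bool" where
  "stationary_on K D w \<longleftrightarrow>
     continuous_on D w \<and> w ` D \<subseteq> Om K \<and>
     (\<forall>x\<in>D. ((\<lambda>y. flux K (w y)) has_vector_derivative src K (w x) x) (at x within D))"


section \<open>Mesh and cell averages\<close>

definition dx :: "('m::finite) kinetic_fv \<Rightarrow> real" where
  "dx K = (right_end K - left_end K) / real (Nx K)"

text \<open>\<open>iface K i\<close> is the interface \<open>x\<^bsub>i+1/2\<^esub>\<close>, the right end of cell \<open>i\<close>.\<close>

definition iface :: "('m::finite) kinetic_fv \<Rightarrow> int \<Rightarrow> real" where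
  "iface K i = left_end K + of_int i * dx K"

definition center :: "('m::finite) kinetic_fv \<Rightarrow> int \<Rightarrow> real" where
  "center K i = (iface K (i - 1) + iface K i) / 2"

definition cell :: "('m::finite) kinetic_fv \<Rightarrow> int \<Rightarrow> real set" where
  "cell K i = {iface K (i - 1) <..< iface K i}"

definition inner_cells :: "('m::finite) kinetic_fv \<Rightarrow> int set" where
  "inner_cells K = {1 .. int (Nx K)}"

definition all_cells :: "('m::finite) kinetic_fv \<Rightarrow> int set" where
  "all_cells K = {1 - int (ngh K) .. int (Nx K) + int (ngh K)}"

definition extended_domain :: "('m::finite) kinetic_fv \<Rightarrow> real set" where
  "extended_domain K = {iface K (- int (ngh K)) .. iface K (int (Nx K) + int (ngh K))}"

text \<open>
  The interface fluxes of the cells \<open>1..Nx\<close> need the reconstruction in one further cell on each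
  side.
\<close>

definition recon_cells :: "('m::finite) kinetic_fv \<Rightarrow> int set" where
  "recon_cells K = {0 .. int (Nx K) + 1}"

definition stencil :: "('m::finite) kinetic_fv \<Rightarrow> int \<Rightarrow> int set" where
  "stencil K i = {i - int (sl K i) .. i + int (sr K i)}"

definition stencil_domain :: "('m::finite) kinetic_fv \<Rightarrow> int \<Rightarrow> real set" where
  "stencil_domain K i = {iface K (i - int (sl K i) - 1) .. iface K (i + int (sr K i))}"

definition mesh :: "('m::finite) kinetic_fv \<Rightarrow> bool" where
  "mesh K \<longleftrightarrow> left_end K < right_end K \<and> 0 < Nx K \<and>
     (\<forall>i\<in>recon_cells K. stencil K i \<subseteq> all_cells K)"

definition quadrature_average :: "('m::finite) kinetic_fv \<Rightarrow> bool" where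
  "quadrature_average K \<longleftrightarrow>
     (\<exists>(M::nat) (\<omega>::nat \<Rightarrow> real) (xq::int \<Rightarrow> nat \<Rightarrow> real).
        (\<Sum>m=1..M. \<omega> m) = 1 \<and>
        (\<forall>i. \<forall>m\<in>{1..M}. xq i m \<in> cell K i) \<and>
        (\<forall>i w. avg K i w = (\<Sum>m=1..M. \<omega> m *\<^sub>R w (xq i m))))"

definition exact_average :: "('m::finite) kinetic_fv \<Rightarrow> bool" where
  "exact_average K \<longleftrightarrow>
     (\<forall>i w. avg K i w = (1 / dx K) *\<^sub>R integral {iface K (i - 1) .. iface K i} w)"


section \<open>Well-balanced reconstruction\<close>

definition local_stationary ::
    "('m::finite) kinetic_fv \<Rightarrow> int \<Rightarrow> real^'m \<Rightarrow> (real \<Rightarrow> real^'m) \<Rightarrow> bool" where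
  "local_stationary K i c w \<longleftrightarrow> stationary_on K (stencil_domain K i) w \<and> avg K i w = c"

definition selects_local_stationary :: "('m::finite) kinetic_fv \<Rightarrow> bool" where
  "selects_local_stationary K \<longleftrightarrow>
     (\<forall>u. \<forall>i\<in>recon_cells K.
        if \<exists>w. local_stationary K i (u i) w
        then local_stationary K i (u i) (locsol K u i)
        else locsol K u i = (\<lambda>x. 0))"

text \<open>
  \<open>Qop K i v\<close> depends only on the averages in the stencil. It is continuous on the closed cell, so
  that its interface values are the traces from inside the cell.
\<close>

definition standard_reconstruction :: "('m::finite) kinetic_fv \<Rightarrow> bool" where
  "standard_reconstruction K \<longleftrightarrow>
     (\<forall>i\<in>recon_cells K.
        (\<forall>v v'. (\<forall>j\<in>stencil K i. v j = v' j) \<longrightarrow> Qop K i v = Qop K i v') \<and>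
        (\<forall>v. continuous_on {iface K (i - 1) .. iface K i} (Qop K i v)) \<and>
        (\<forall>x\<in>{iface K (i - 1) .. iface K i}. Qop K i (\<lambda>j. 0) x = 0))"

definition recon ::
    "('m::finite) kinetic_fv \<Rightarrow> (int \<Rightarrow> real^'m) \<Rightarrow> int \<Rightarrow> real \<Rightarrow> real^'m" where
  "recon K u i x = locsol K u i x + Qop K i (\<lambda>j. u j - avg K j (locsol K u i)) x"

definition exactly_well_balanced ::
    "('m::finite) kinetic_fv \<Rightarrow> (real \<Rightarrow> real^'m) \<Rightarrow> (int \<Rightarrow> real^'m) \<Rightarrow> bool" where
  "exactly_well_balanced K us ue \<longleftrightarrow>
     (\<forall>i\<in>recon_cells K. \<forall>x\<in>cell K i. recon K ue i x = us x)"

text \<open>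
  Several stationary solutions may have the same average in cell \<open>i\<close>. This says that the selection
  made for the averages \<open>ue\<close> is \<open>us\<close> itself on the cell, which does not follow from
  \<open>exactly_well_balanced\<close>.
\<close>

definition selection_recovers ::
    "('m::finite) kinetic_fv \<Rightarrow> (real \<Rightarrow> real^'m) \<Rightarrow> (int \<Rightarrow> real^'m) \<Rightarrow> bool" where
  "selection_recovers K us ue \<longleftrightarrow>
     (\<forall>i\<in>inner_cells K. \<forall>x\<in>cell K i. locsol K ue i x = us x)"


section \<open>The scheme\<close>

definition iflux_plus :: "('m::finite) kinetic_fv \<Rightarrow> (int \<Rightarrow> real^'m) \<Rightarrow> int \<Rightarrow> real^'m" where
  "iflux_plus K u i = mplus K (recon K u i (iface K i))"

definition iflux_minus :: "('m::finite) kinetic_fv \<Rightarrow> (int \<Rightarrow> real^'m) \<Rightarrow> int \<Rightarrow> real^'m" where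
  "iflux_minus K u i = mminus K (recon K u (i + 1) (iface K i))"

text \<open>In the three steps \<open>u\<close> stands for \<open>u\<^sup>n\<close>, that is, for the sum of the two kinetic unknowns.\<close>

definition transport_plus ::
    "('m::finite) kinetic_fv \<Rightarrow> real \<Rightarrow> (int \<Rightarrow> real^'m) \<Rightarrow> (int \<Rightarrow> real^'m) \<Rightarrow> int \<Rightarrow> real^'m" where
  "transport_plus K dt u fp i =
     fp i - (kspeed K * (dt / dx K)) *\<^sub>R (iflux_plus K u i - iflux_plus K u (i - 1))
          + (kspeed K * (dt / dx K)) *\<^sub>R
              (mplus K (locsol K u i (iface K i)) - mplus K (locsol K u i (iface K (i - 1))))"

definition transport_minus ::
    "('m::finite) kinetic_fv \<Rightarrow> real \<Rightarrow> (int \<Rightarrow> real^'m) \<Rightarrow> (int \<Rightarrow> real^'m) \<Rightarrow> int \<Rightarrow> real^'m" where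
  "transport_minus K dt u fm i =
     fm i + (kspeed K * (dt / dx K)) *\<^sub>R (iflux_minus K u i - iflux_minus K u (i - 1))
          - (kspeed K * (dt / dx K)) *\<^sub>R
              (mminus K (locsol K u i (iface K i)) - mminus K (locsol K u i (iface K (i - 1))))"

text \<open>\<open>w\<close> solves the implicit system of the source step in cell \<open>i\<close> for \<open>u\<^sup>n\<^sup>,\<^sup>* = us\<close>.\<close>

definition source_system ::
    "('m::finite) kinetic_fv \<Rightarrow> real \<Rightarrow> (int \<Rightarrow> real^'m) \<Rightarrow> int \<Rightarrow> real^'m \<Rightarrow> real^'m \<Rightarrow> bool" where
  "source_system K dt u i us w \<longleftrightarrow> w \<in> Om K \<and>
     w = us + (dt / 2) *\<^sub>R (src K us (center K i) + src K w (center K i)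
                            - 2 *\<^sub>R src K (avg K i (locsol K u i)) (center K i))"

definition projection ::
    "('m::finite) kinetic_fv \<Rightarrow> real \<Rightarrow> (real^'m \<Rightarrow> real^'m) \<Rightarrow>
      real^'m \<Rightarrow> real^'m \<Rightarrow> real^'m \<Rightarrow> real^'m" where
  "projection K dt m fs us w =
     (let \<omega> = 2 - Cproj K * dt in (1 - \<omega>) *\<^sub>R fs + (\<omega> / 2) *\<^sub>R (m us + m w))"

text \<open>
  One time step is a relation, because the implicit system of the source step need not have a
  unique solution. The result \<open>(fp', fm')\<close> is constrained only in the cells \<open>1..Nx\<close>.
\<close>

definition kinetic_step ::
    "('m::finite) kinetic_fv \<Rightarrow> real \<Rightarrow> (int \<Rightarrow> real^'m) \<Rightarrow> (int \<Rightarrow> real^'m) \<Rightarrow>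
      (int \<Rightarrow> real^'m) \<Rightarrow> (int \<Rightarrow> real^'m) \<Rightarrow> bool" where
  "kinetic_step K dt fp fm fp' fm' \<longleftrightarrow>
     (let u = (\<lambda>j. fm j + fp j);
          fps = transport_plus K dt u fp;
          fms = transport_minus K dt u fm;
          us = (\<lambda>i. fms i + fps i)
      in \<exists>w. \<forall>i\<in>inner_cells K.
           source_system K dt u i (us i) (w i) \<and>
           fp' i = projection K dt (mplus K) (fps i) (us i) (w i) \<and>
           fm' i = projection K dt (mminus K) (fms i) (us i) (w i))"

definition S1expFV ::
    "('m::finite) kinetic_fv \<Rightarrow> real \<Rightarrow> (int \<Rightarrow> real^'m) \<Rightarrow> (int \<Rightarrow> real^'m) \<Rightarrow> bool" where
  "S1expFV K dt u u' \<longleftrightarrow>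
     (\<exists>fp' fm'. kinetic_step K dt (\<lambda>j. mplus K (u j)) (\<lambda>j. mminus K (u j)) fp' fm' \<and>
        (\<forall>i\<in>inner_cells K. u' i = fm' i + fp' i))"

definition source_solution_unique ::
    "('m::finite) kinetic_fv \<Rightarrow> real \<Rightarrow> (int \<Rightarrow> real^'m) \<Rightarrow> int \<Rightarrow> bool" where
  "source_solution_unique K dt u i \<longleftrightarrow>
     (\<exists>\<^sub>\<le>\<^sub>1 w. source_system K dt u i
        (transport_minus K dt u (\<lambda>j. mminus K (u j)) i + transport_plus K dt u (\<lambda>j. mplus K (u j)) i) w)"

end

theory Submission
  imports Defs
begin

text \<open>
  For the averages \<open>ue\<close>, both the reconstruction and the local stationary solution coincide, by
  hypothesis, with \<open>us\<close> on the open cells that matter. All three functions are continuous up to the interfaces, so the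
  coincidence extends to the interface values (lemmas \<open>recon_eq_on_closed_cell\<close> and
  \<open>locsol_eq_on_closed_cell\<close>). For the local solution this continuity comes from the selection rule:
  \<open>us\<close> itself is an admissible candidate on every stencil, so the rule never falls back on the zero
  function.

  Hence the upwind fluxes at each interface are the kinetic equilibria \<open>m\<^sub>\<plusminus>\<close> of the single value
  of \<open>us\<close> there, the flux difference in the transport step is cancelled by the correction built from the local
  solution, and the kinetic unknowns stay at equilibrium. The local solution has average \<open>ue i\<close>, so
  the source increments cancel and \<open>ue i\<close> solves the implicit system. For this solution the
  projection is an affine combination of equal vectors, for every value of \<open>\<omega>\<close>,
  so the step returns \<open>ue i\<close>; where the implicit system has no other solution, it can return nothing
  else.
\<close>

lemma mminus_add_mplus [simp]: "mminus K u + mplus K u = u"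
  by (simp add: mplus_def mminus_def flip: scaleR_add_left)

lemma dx_pos:
  assumes "mesh K"
  shows "dx K > 0"
  using assms by (simp add: mesh_def dx_def)

lemma iface_less_iff:
  assumes "mesh K"
  shows "iface K i < iface K j \<longleftrightarrow> i < j"
  using dx_pos[OF assms] by (simp add: iface_def)

lemma iface_le_iff:
  assumes "mesh K"
  shows "iface K i \<le> iface K j \<longleftrightarrow> i \<le> j"
  using dx_pos[OF assms] by (simp add: iface_def)

lemma stencil_domain_subset_extended_domain:
  assumes mesh: "mesh K" and i: "i \<in> recon_cells K"
  shows "stencil_domain K i \<subseteq> extended_domain K"
proof -
  have "stencil K i \<subseteq> all_cells K"
    using mesh i by (simp add: mesh_def)
  then have "- int (ngh K) \<le> i - int (sl K i) - 1" "i + int (sr K i) \<le> int (Nx K) + int (ngh K)"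
    by (auto simp: stencil_def all_cells_def)
  then show ?thesis
    by (simp add: stencil_domain_def extended_domain_def iface_le_iff[OF mesh])
qed

lemma closed_cell_subset_stencil_domain:
  assumes "mesh K"
  shows "{iface K (i - 1) .. iface K i} \<subseteq> stencil_domain K i"
  by (simp add: stencil_domain_def iface_le_iff[OF assms])

lemma recon_cells_subset_all_cells:
  assumes "mesh K"
  shows "recon_cells K \<subseteq> all_cells K"
proof
  fix i assume "i \<in> recon_cells K"
  then have "stencil K i \<subseteq> all_cells K"
    using assms by (simp add: mesh_def)
  then show "i \<in> all_cells K"
    by (auto simp: stencil_def)
qed

lemma stationary_on_subset:
  assumes "stationary_on K D w" "E \<subseteq> D"
  shows "stationary_on K E w"
  using assms unfolding stationary_on_def
  by (blast intro: continuous_on_subset has_vector_derivative_within_subset)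

lemma eq_on_closed_cell:
  fixes g h :: "real \<Rightarrow> 'b::real_normed_vector"
  assumes mesh: "mesh K"
    and g: "continuous_on {iface K (i - 1) .. iface K i} g"
    and h: "continuous_on {iface K (i - 1) .. iface K i} h"
    and eq: "\<forall>x\<in>cell K i. g x = h x"
    and x: "x \<in> {iface K (i - 1) .. iface K i}"
  shows "g x = h x"
proof -
  have "iface K (i - 1) < iface K i"
    by (simp add: iface_less_iff[OF mesh])
  then have cl: "closure (cell K i) = {iface K (i - 1) .. iface K i}"
    by (simp add: cell_def)
  have "g x - h x = 0"
    by (rule continuous_constant_on_closure[where S = "cell K i" and f = "\<lambda>y. g y - h y"])
      (use g h eq x cl in \<open>auto intro: continuous_on_diff\<close>)
  then show ?thesis
    by simp
qed

lemma local_stationary_locsol: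
  assumes mesh: "mesh K" and step1: "selects_local_stationary K"
    and stat: "stationary_on K (extended_domain K) us"
    and averages: "\<forall>j\<in>all_cells K. ue j = avg K j us"
    and i: "i \<in> recon_cells K"
  shows "local_stationary K i (ue i) (locsol K ue i)"
proof -
  have "local_stationary K i (ue i) us"
    using stationary_on_subset[OF stat stencil_domain_subset_extended_domain[OF mesh i]]
      averages i recon_cells_subset_all_cells[OF mesh]
    by (auto simp: local_stationary_def)
  then show ?thesis
    using step1 i unfolding selects_local_stationary_def by (metis (no_types, lifting))
qed

lemma continuous_on_locsol:
  assumes "mesh K" "local_stationary K i c w"
  shows "continuous_on {iface K (i - 1) .. iface K i} w"
  using assms closed_cell_subset_stencil_domain[OF assms(1)]
  by (auto simp: local_stationary_def stationary_on_def intro: continuous_on_subset)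

lemma continuous_on_stationary_cell:
  assumes mesh: "mesh K" and stat: "stationary_on K (extended_domain K) us"
    and i: "i \<in> recon_cells K"
  shows "continuous_on {iface K (i - 1) .. iface K i} us"
  using stat stencil_domain_subset_extended_domain[OF mesh i]
    closed_cell_subset_stencil_domain[OF mesh, of i]
  unfolding stationary_on_def by (meson continuous_on_subset)

lemma recon_eq_on_closed_cell:
  assumes mesh: "mesh K" and step1: "selects_local_stationary K"
    and standard: "standard_reconstruction K"
    and stat: "stationary_on K (extended_domain K) us"
    and averages: "\<forall>j\<in>all_cells K. ue j = avg K j us"
    and balanced: "exactly_well_balanced K us ue"
    and i: "i \<in> recon_cells K" and x: "x \<in> {iface K (i - 1) .. iface K i}"
  shows "recon K ue i x = us x"
proof (rule eq_on_closed_cell[OF mesh _ _ _ x])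
  show "continuous_on {iface K (i - 1) .. iface K i} us"
    by (rule continuous_on_stationary_cell[OF mesh stat i])
  show "continuous_on {iface K (i - 1) .. iface K i} (recon K ue i)"
    unfolding recon_def
  proof (rule continuous_on_add)
    show "continuous_on {iface K (i - 1) .. iface K i} (locsol K ue i)"
      by (rule continuous_on_locsol[OF mesh local_stationary_locsol[OF mesh step1 stat averages i]])
    show "continuous_on {iface K (i - 1) .. iface K i}
        (Qop K i (\<lambda>j. ue j - avg K j (locsol K ue i)))"
      using standard i unfolding standard_reconstruction_def by blast
  qed
  show "\<forall>x\<in>cell K i. recon K ue i x = us x"
    using balanced i by (simp add: exactly_well_balanced_def)
qed

lemma inner_cells_subset_recon_cells:
  "inner_cells K \<subseteq> recon_cells K"
  by (auto simp: inner_cells_def recon_cells_def)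

lemma locsol_eq_on_closed_cell:
  assumes mesh: "mesh K" and step1: "selects_local_stationary K"
    and stat: "stationary_on K (extended_domain K) us"
    and averages: "\<forall>j\<in>all_cells K. ue j = avg K j us"
    and recovers: "selection_recovers K us ue"
    and i: "i \<in> inner_cells K" and x: "x \<in> {iface K (i - 1) .. iface K i}"
  shows "locsol K ue i x = us x"
proof (rule eq_on_closed_cell[OF mesh _ _ _ x])
  have i': "i \<in> recon_cells K"
    using i inner_cells_subset_recon_cells by blast
  show "continuous_on {iface K (i - 1) .. iface K i} us"
    by (rule continuous_on_stationary_cell[OF mesh stat i'])
  show "continuous_on {iface K (i - 1) .. iface K i} (locsol K ue i)"
    by (rule continuous_on_locsol[OF mesh local_stationary_locsol[OF mesh step1 stat averages i']])
  show "\<forall>x\<in>cell K i. locsol K ue i x = us x"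
    using recovers i by (simp add: selection_recovers_def)
qed

text \<open>
  If the reconstructions on both sides of each interface of cell \<open>i\<close>, and the local solution, all
  take the value of \<open>us\<close> there, the transport step does not change the kinetic unknowns of cell \<open>i\<close>,
  whatever these are.
\<close>

lemma transport_fixed:
  assumes right: "\<And>j. j \<in> {i - 1, i} \<Longrightarrow> recon K u j (iface K j) = us (iface K j)"
    and left: "\<And>j. j \<in> {i - 1, i} \<Longrightarrow> recon K u (j + 1) (iface K j) = us (iface K j)"
    and loc: "\<And>j. j \<in> {i - 1, i} \<Longrightarrow> locsol K u i (iface K j) = us (iface K j)"
  shows "transport_plus K dt u fp i = fp i" and "transport_minus K dt u fm i = fm i"
  using right[of i] right[of "i - 1"] left[of i] left[of "i - 1"] loc[of i] loc[of "i - 1"]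
  by (simp_all add: transport_plus_def transport_minus_def iflux_plus_def iflux_minus_def)

lemma projection_equilibrium:
  "projection K dt m (m v) v v = m v"
proof -
  have "(\<omega> / 2) *\<^sub>R (m v + m v) = \<omega> *\<^sub>R m v" for \<omega> :: real
    by (simp flip: scaleR_2)
  then show ?thesis
    by (simp add: projection_def Let_def flip: scaleR_add_left)
qed

theorem theorem3p1:
  fixes K :: "('m::finite) kinetic_fv"
    and us :: "real \<Rightarrow> real^'m"
    and ue :: "int \<Rightarrow> real^'m"
    and dt :: real
  assumes law: "hyperbolic_law K"
    and speed: "kspeed K > 0"
    and subchar: "subcharacteristic K (us ` extended_domain K)"
    and mesh: "mesh K"
    and averaging: "quadrature_average K \<or> exact_average K"
    and step1: "selects_local_stationary K"
    and standard: "standard_reconstruction K"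
    and stationary: "stationary_on K (extended_domain K) us"
    and averages: "\<forall>j\<in>all_cells K. ue j = avg K j us"
    and admissible: "\<forall>j\<in>all_cells K. ue j \<in> Om K"
    and balanced: "exactly_well_balanced K us ue"
    and recovers: "selection_recovers K us ue"
    and dt: "dt > 0"
  shows "S1expFV K dt ue ue \<and>
    (\<forall>u'. S1expFV K dt ue u' \<longrightarrow>
      (\<forall>i\<in>inner_cells K. source_solution_unique K dt ue i \<longrightarrow> u' i = ue i))"
proof -
  have rec: "recon K ue j x = us x"
    if "j \<in> recon_cells K" "x \<in> {iface K (j - 1) .. iface K j}" for j x
    by (rule recon_eq_on_closed_cell[OF mesh step1 standard stationary averages balanced that])
  have transport:
    "transport_plus K dt ue fp i = fp i" "transport_minus K dt ue fm i = fm i"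
    if i: "i \<in> inner_cells K" for i and fp fm :: "int \<Rightarrow> real^'m"
  proof -
    have right: "recon K ue j (iface K j) = us (iface K j)" if "j \<in> {i - 1, i}" for j
      by (rule rec) (use i that in \<open>auto simp: inner_cells_def recon_cells_def iface_le_iff[OF mesh]\<close>)
    have left: "recon K ue (j + 1) (iface K j) = us (iface K j)" if "j \<in> {i - 1, i}" for j
      by (rule rec) (use i that in \<open>auto simp: inner_cells_def recon_cells_def iface_le_iff[OF mesh]\<close>)
    have loc: "locsol K ue i (iface K j) = us (iface K j)" if "j \<in> {i - 1, i}" for j
      by (rule locsol_eq_on_closed_cell[OF mesh step1 stationary averages recovers i])
        (use that in \<open>auto simp: iface_le_iff[OF mesh]\<close>)
    show "transport_plus K dt ue fp i = fp i" "transport_minus K dt ue fm i = fm i"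
      using transport_fixed[of i K ue us, OF right left loc] by auto
  qed
  have source: "source_system K dt ue i (ue i) (ue i)" if i: "i \<in> inner_cells K" for i
  proof -
    have i': "i \<in> recon_cells K"
      using i inner_cells_subset_recon_cells by blast
    have "avg K i (locsol K ue i) = ue i"
      using local_stationary_locsol[OF mesh step1 stationary averages i']
      by (simp add: local_stationary_def)
    moreover have "ue i \<in> Om K"
      using admissible i' recon_cells_subset_all_cells[OF mesh] by blast
    ultimately show ?thesis
      by (simp add: source_system_def flip: scaleR_2)
  qed
  have step_iff: "kinetic_step K dt (\<lambda>j. mplus K (ue j)) (\<lambda>j. mminus K (ue j)) fp' fm' \<longleftrightarrow>
      (\<exists>w. \<forall>i\<in>inner_cells K. source_system K dt ue i (ue i) (w i) \<and>
         fp' i = projection K dt (mplus K) (mplus K (ue i)) (ue i) (w i) \<and>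
         fm' i = projection K dt (mminus K) (mminus K (ue i)) (ue i) (w i))" for fp' fm'
    by (simp add: kinetic_step_def Let_def transport cong: ball_cong)
  have "S1expFV K dt ue ue"
    unfolding S1expFV_def step_iff
    by (intro exI[of _ "\<lambda>j. mplus K (ue j)"] exI[of _ "\<lambda>j. mminus K (ue j)"] exI[of _ ue] conjI)
      (simp_all add: source projection_equilibrium)
  moreover have "u' i = ue i"
    if S: "S1expFV K dt ue u'" and i: "i \<in> inner_cells K" and uniq: "source_solution_unique K dt ue i"
    for u' i
  proof -
    obtain w fp' fm' where w: "source_system K dt ue i (ue i) (w i)"
      and fp': "fp' i = projection K dt (mplus K) (mplus K (ue i)) (ue i) (w i)"
      and fm': "fm' i = projection K dt (mminus K) (mminus K (ue i)) (ue i) (w i)"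
      and u': "u' i = fm' i + fp' i"
      using S i unfolding S1expFV_def step_iff by blast
    have "\<exists>\<^sub>\<le>\<^sub>1 v. source_system K dt ue i (ue i) v"
      using uniq by (simp add: source_solution_unique_def transport[OF i])
    then have "w i = ue i"
      using w source[OF i] by (rule Uniq_D)
    then show ?thesis
      by (simp add: u' fp' fm' projection_equilibrium)
  qed
  ultimately show ?thesis
    by blast
qed

end
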